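(* Let $a:(0,\infty)\to(0,\infty)$ be a continuous function such that $\lim_{t\to\infty}\int_t^{t+\eta}a(s)\,ds>0$ for some $\eta>0$. Let $b:\mathbb{R}\to[0,\infty)$ be a continuous function for which there exist $-\infty\le l<\infty$ and $-\infty<r<\infty$ such that $b>0$ and $b$ is locally Lipschitz on $(l,\infty)$, and $b:[r,\infty)\to(0,\infty)$ is non-decreasing. Let $x_0>r$, $t_0\ge 0$ and $T>t_0$, and let $u,v:[t_0,T]\to\mathbb{R}$ be two continuous functions. (a) Suppose that, for all $t\in[t_0,T]$, $$v(t)>x_0+\int_{t_0}^t a(s)b(v(s))\,ds,\qquad u(t)=x_0+\int_{t_0}^t a(s)b(u(s))\,ds .$$ Then $v(t)\ge u(t)$ for all $t\in[t_0,T]$. (b) Suppose that, for all $t\in[t_0,T]$, $$r<v(t)<x_0+\int_{t_0}^t a(s)b(v(s))\,ds,\qquad u(t)=x_0+\int_{t_0}^t a(s)b(u(s))\,ds .$$ Then $v(t)\le u(t)$ for all $t\in[t_0,T]$.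
   Context: All integrals appearing in the hypotheses are understood to be finite. *)

theory Defs
  imports "HOL-Analysis.Analysis"
begin

text \<open>
  The library's \<open>local_lipschitz\<close> is about families of functions indexed by a metric
  space; for a single function we take the constant family. The lemma below gives the
  usual formulation: every point has a neighbourhood on which the function is Lipschitz.
\<close>

definition locally_lipschitz_on :: "real set \<Rightarrow> (real \<Rightarrow> real) \<Rightarrow> bool" where
  "locally_lipschitz_on X f \<longleftrightarrow> local_lipschitz (UNIV :: real set) X (\<lambda>_. f)"

lemma locally_lipschitz_on_iff:
  "locally_lipschitz_on X f \<longleftrightarrow>
     (\<forall>x\<in>X. \<exists>e>0. \<exists>L. L-lipschitz_on (cball x e \<inter> X) f)"
proof -
  have "cball y e \<noteq> {}" if "e > 0" for y e :: real
    using that by simp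
  then have "(\<forall>t\<in>cball y e \<inter> UNIV. Q) \<longleftrightarrow> Q" if "e > 0" for y e :: real and Q
    using that by (metis Int_UNIV_right ex_in_conv)
  then show ?thesis
    unfolding locally_lipschitz_on_def local_lipschitz_def by (metis UNIV_I)
qed

end

theory Submission imports Defs begin

text \<open>
  Two continuous functions that are strictly ordered at \<open>t0\<close> and later lose their order do so at a
  first time. If the smaller one stays at or above \<open>r\<close>, then up to that time both run in the
  half-line where \<open>b\<close> is monotone, so the integral of \<open>a \<cdot> b\<close> along the larger function dominates the
  one along the smaller function. As one of the two integral relations is strict, the functions
  are still strictly ordered at that time, which is a contradiction. This is
  \<open>integral_comparison_strict\<close>.

  In part (a) the smaller function is \<open>u\<close>; its integrand is nonnegative, so that \<open>u \<ge> x0 > r\<close>.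
  In part (b) it is \<open>v\<close>; a strict subsolution has no such lower bound of its own, whence the
  hypothesis \<open>r < v t\<close>.
\<close>

text \<open>
  The set where the order fails is compact, so if it were nonempty it would have a least element;
  but the step hypothesis restores the order there. If that element is \<open>t0\<close>, the range of the
  premise is empty, so the step hypothesis also contains the strict order at the start.
\<close>

lemma continuous_less_by_first_crossing:
  fixes p q :: "real \<Rightarrow> real"
  assumes p: "continuous_on {t0..T} p" and q: "continuous_on {t0..T} q"
    and step: "\<And>t. t \<in> {t0..T} \<Longrightarrow> (\<And>s. t0 \<le> s \<Longrightarrow> s < t \<Longrightarrow> q s < p s) \<Longrightarrow> q t < p t"
    and t: "t \<in> {t0..T}"
  shows "q t < p t"
proof (rule ccontr)
  define S where "S = {s \<in> {t0..T}. p s \<le> q s}"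
  assume "\<not> q t < p t"
  then have "S \<noteq> {}"
    using t by (auto simp: S_def)
  moreover have "compact S"
    unfolding compact_eq_bounded_closed
  proof
    show "bounded S"
      by (rule bounded_subset[OF bounded_closed_interval[of t0 T]]) (auto simp: S_def)
    show "closed S"
      unfolding S_def by (intro continuous_on_closed_Collect_le p q) simp
  qed
  ultimately obtain m where m: "m \<in> S" and least: "\<And>s. s \<in> S \<Longrightarrow> m \<le> s"
    using compact_attains_inf[of S] by metis
  have "q m < p m"
  proof (rule step)
    show "m \<in> {t0..T}"
      using m by (simp add: S_def)
    show "q s < p s" if "t0 \<le> s" "s < m" for s
      using that least[of s] m by (force simp: S_def)
  qed
  with m show False
    by (simp add: S_def)
qed

text \<open>
  The endpoints do not count for the integral; this is what makes the positivity of \<open>a\<close> on the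
  open half-line, and an order that is only known before a crossing time, sufficient.
\<close>

lemma interval_integral_mono_open:
  fixes f g :: "real \<Rightarrow> real"
  assumes "c \<le> d"
    and f: "interval_lebesgue_integrable lborel (ereal c) (ereal d) f"
    and g: "interval_lebesgue_integrable lborel (ereal c) (ereal d) g"
    and le: "\<And>s. c < s \<Longrightarrow> s < d \<Longrightarrow> f s \<le> g s"
  shows "(LBINT s=ereal c..ereal d. f s) \<le> (LBINT s=ereal c..ereal d. g s)"
proof -
  have "(LBINT s:einterval c d. f s) \<le> (LBINT s:einterval c d. g s)"
    using \<open>c \<le> d\<close> f g le
    by (intro set_integral_mono) (auto simp: interval_lebesgue_integrable_def einterval_iff)
  then show ?thesis
    using \<open>c \<le> d\<close> by (simp add: interval_lebesgue_integral_le_eq)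
qed

lemma interval_integral_nonneg_open:
  fixes f :: "real \<Rightarrow> real"
  assumes "c \<le> d" and "interval_lebesgue_integrable lborel (ereal c) (ereal d) f"
    and "\<And>s. c < s \<Longrightarrow> s < d \<Longrightarrow> 0 \<le> f s"
  shows "0 \<le> (LBINT s=ereal c..ereal d. f s)"
proof -
  have "interval_lebesgue_integrable lborel (ereal c) (ereal d) (\<lambda>_. 0 :: real)"
    by (simp add: interval_lebesgue_integrable_def set_integrable_def)
  from interval_integral_mono_open[OF assms(1) this assms(2,3)] show ?thesis
    by simp
qed

text \<open>
  Only the difference of the two integral relations enters, so strictness may come from either
  of them; this lets the two parts of the theorem share one argument.
\<close>

lemma integral_comparison_strict:
  fixes a b p q :: "real \<Rightarrow> real"
  assumes p: "continuous_on {t0..T} p" and q: "continuous_on {t0..T} q"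
    and a: "\<And>s. t0 < s \<Longrightarrow> 0 \<le> a s"
    and b: "mono_on {r..} b"
    and q_ge: "\<And>t. t \<in> {t0..T} \<Longrightarrow> r \<le> q t"
    and int_p: "\<And>t. t \<in> {t0..T} \<Longrightarrow>
      interval_lebesgue_integrable lborel (ereal t0) (ereal t) (\<lambda>s. a s * b (p s))"
    and int_q: "\<And>t. t \<in> {t0..T} \<Longrightarrow>
      interval_lebesgue_integrable lborel (ereal t0) (ereal t) (\<lambda>s. a s * b (q s))"
    and diff: "\<And>t. t \<in> {t0..T} \<Longrightarrow>
      q t - (LBINT s=ereal t0..ereal t. a s * b (q s)) <
      p t - (LBINT s=ereal t0..ereal t. a s * b (p s))"
    and t: "t \<in> {t0..T}"
  shows "q t < p t"
  using p q _ t
proof (rule continuous_less_by_first_crossing)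
  fix t assume t: "t \<in> {t0..T}" and less: "\<And>s. t0 \<le> s \<Longrightarrow> s < t \<Longrightarrow> q s < p s"
  have "(LBINT s=ereal t0..ereal t. a s * b (q s)) \<le> (LBINT s=ereal t0..ereal t. a s * b (p s))"
  proof (rule interval_integral_mono_open)
    fix s assume s: "t0 < s" "s < t"
    then have "r \<le> q s" "q s \<le> p s"
      using q_ge[of s] less[of s] t by auto
    then have "b (q s) \<le> b (p s)"
      using b by (auto intro: mono_onD)
    then show "a s * b (q s) \<le> a s * b (p s)"
      using a[OF s(1)] by (rule mult_left_mono)
  qed (use t int_p int_q in auto)
  with diff[OF t] show "q t < p t"
    by linarith
qed

theorem lemma9:
  fixes a b u v :: "real \<Rightarrow> real" and l :: ereal and r x0 t0 T :: real
  assumes a_cont: "continuous_on {0<..} a"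
    and a_pos: "\<And>t. t > 0 \<Longrightarrow> a t > 0"
    and a_lim: "\<exists>\<eta>::real. \<eta> > 0 \<and> (\<exists>L::ereal. L > 0 \<and>
                  ((\<lambda>t::real. ereal (LBINT s=ereal t..ereal (t + \<eta>). a s)) \<longlongrightarrow> L) at_top)"
    and b_cont: "continuous_on UNIV b"
    and b_nonneg: "\<And>x. b x \<ge> 0"
    and l_fin: "l < \<infinity>"
    and b_pos_l: "\<And>x. l < ereal x \<Longrightarrow> b x > 0"
    and b_lip: "locally_lipschitz_on {x. l < ereal x} b"
    and b_pos_r: "\<And>x. x \<ge> r \<Longrightarrow> b x > 0"
    and b_mono: "mono_on {r..} b"
    and x0: "x0 > r"
    and t0: "t0 \<ge> 0"
    and T: "T > t0"
    and u_cont: "continuous_on {t0..T} u"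
    and v_cont: "continuous_on {t0..T} v"
  shows
    "((\<forall>t\<in>{t0..T}.
         interval_lebesgue_integrable lborel (ereal t0) (ereal t) (\<lambda>s. a s * b (v s)) \<and>
         interval_lebesgue_integrable lborel (ereal t0) (ereal t) (\<lambda>s. a s * b (u s)) \<and>
         v t > x0 + (LBINT s=ereal t0..ereal t. a s * b (v s)) \<and>
         u t = x0 + (LBINT s=ereal t0..ereal t. a s * b (u s)))
       \<longrightarrow> (\<forall>t\<in>{t0..T}. v t \<ge> u t))
     \<and>
     ((\<forall>t\<in>{t0..T}.
         interval_lebesgue_integrable lborel (ereal t0) (ereal t) (\<lambda>s. a s * b (v s)) \<and>
         interval_lebesgue_integrable lborel (ereal t0) (ereal t) (\<lambda>s. a s * b (u s)) \<and>
         r < v t \<and> v t < x0 + (LBINT s=ereal t0..ereal t. a s * b (v s)) \<and>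
         u t = x0 + (LBINT s=ereal t0..ereal t. a s * b (u s)))
       \<longrightarrow> (\<forall>t\<in>{t0..T}. v t \<le> u t))"
proof (intro conjI impI ballI)
  have nonneg: "0 \<le> (LBINT s=ereal t0..ereal t. a s * b (w s))"
    if "t \<in> {t0..T}"
      and "interval_lebesgue_integrable lborel (ereal t0) (ereal t) (\<lambda>s. a s * b (w s))" for t w
    using that a_pos t0 b_nonneg
    by (intro interval_integral_nonneg_open mult_nonneg_nonneg) (auto intro: less_imp_le)
  have a: "0 \<le> a s" if "t0 < s" for s
    using that t0 a_pos[of s] by simp
  {
    fix t
    assume H: "\<forall>t\<in>{t0..T}.
         interval_lebesgue_integrable lborel (ereal t0) (ereal t) (\<lambda>s. a s * b (v s)) \<and>
         interval_lebesgue_integrable lborel (ereal t0) (ereal t) (\<lambda>s. a s * b (u s)) \<and>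
         v t > x0 + (LBINT s=ereal t0..ereal t. a s * b (v s)) \<and>
         u t = x0 + (LBINT s=ereal t0..ereal t. a s * b (u s))"
      and t: "t \<in> {t0..T}"
    have "r \<le> u t" if t: "t \<in> {t0..T}" for t
      using nonneg[OF t, of u] bspec[OF H t] x0 by linarith
    moreover have "u t - (LBINT s=ereal t0..ereal t. a s * b (u s)) <
        v t - (LBINT s=ereal t0..ereal t. a s * b (v s))" if t: "t \<in> {t0..T}" for t
      using bspec[OF H t] by linarith
    ultimately have "u t < v t"
      using H t by (intro integral_comparison_strict[OF v_cont u_cont a b_mono]) blast+
    then show "v t \<ge> u t"
      by simp
  next
    fix t
    assume H: "\<forall>t\<in>{t0..T}.
         interval_lebesgue_integrable lborel (ereal t0) (ereal t) (\<lambda>s. a s * b (v s)) \<and>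
         interval_lebesgue_integrable lborel (ereal t0) (ereal t) (\<lambda>s. a s * b (u s)) \<and>
         r < v t \<and> v t < x0 + (LBINT s=ereal t0..ereal t. a s * b (v s)) \<and>
         u t = x0 + (LBINT s=ereal t0..ereal t. a s * b (u s))"
      and t: "t \<in> {t0..T}"
    have "r \<le> v t" if t: "t \<in> {t0..T}" for t
      using bspec[OF H t] by linarith
    moreover have "v t - (LBINT s=ereal t0..ereal t. a s * b (v s)) <
        u t - (LBINT s=ereal t0..ereal t. a s * b (u s))" if t: "t \<in> {t0..T}" for t
      using bspec[OF H t] by linarith
    ultimately have "v t < u t"
      using H t by (intro integral_comparison_strict[OF u_cont v_cont a b_mono]) blast+
    then show "v t \<le> u t"
      by simp
  }
qed

end
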